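(* Let $\mathbb{F}_q$ be a finite field, let $k,m\ge 2$ and $n\ge 3$ be integers with $\operatorname{char}(\mathbb{F}_q)\nmid mk$ and $n<mk$, and let $a,b,a_1,\dots,a_n\in\mathbb{F}_q^*$. Let $N$ be the number of solutions $(x_1,\dots,x_n)\in\mathbb{F}_q^n$ of $$(a_1X_1^m+\cdots+a_nX_n^m+a)^k=bX_1\cdots X_n.$$ Then $$\big|N-q^{n-1}\big|\le 9\,(mk)^{\max\{n-1,4\}}\,q^{n-3/2}.$$ *)

theory Defs
  imports "HOL-Analysis.Analysis" "HOL-Computational_Algebra.Computational_Algebra"
begin

end

theory Submission
  imports Defs "HOL-Library.Real_Mod" "HOL-Number_Theory.Cong" "HOL-Algebra.Multiplicative_Group"
begin

text \<open>
  Write \<open>S(x) = c\<^sub>1 x\<^sub>1\<^sup>m + \<dots> + c\<^sub>n x\<^sub>n\<^sup>m + a\<close>. Orthogonality of multiplicative characters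
  expresses the number of solutions with \<open>S(x) \<noteq> 0\<close> through the sums of
  \<open>\<chi>\<^sup>k(S(x)) \<chi>\<^sup>-\<^sup>1(b x\<^sub>1\<dots>x\<^sub>n)\<close>, and Gauss sums turn \<open>\<chi>\<^sup>k(S(x))\<close> into a sum over \<open>t\<close> of
  additive characters \<open>\<psi>(t S(x))\<close>. The sum over \<open>x\<close> then factors into one-variable sums
  \<open>\<Sum>\<^sub>y \<chi>\<^sup>-\<^sup>1(y) \<psi>(t c\<^sub>i y\<^sup>m)\<close>, each of which is, as a function of \<open>t\<close>, a combination of at most
  \<open>m\<close> multiplicative characters with coefficients of modulus at most \<open>\<surd>q\<close>. Expanding the product,
  the sum over \<open>t\<close> becomes a combination of Gauss sums, so every nontrivial \<open>\<chi>\<close> contributes at most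
  \<open>(m\<surd>q)\<^sup>n\<close>. The solutions with \<open>S(x) = 0\<close> and the trivial character together
  give \<open>q\<^sup>n\<^sup>-\<^sup>1\<close> up to errors of the same kind. Altogether the error is at most \<open>4 (m\<surd>q)\<^sup>n\<close>,
  which implies the claim unless \<open>n \<ge> 5\<close> and \<open>m > q\<close>, when the trivial bound \<open>q\<^sup>n\<close> suffices.
\<close>

section \<open>Cyclic multiplicative group and a nontrivial additive character\<close>

lemma finite_field_generator:
  obtains g :: "'a::finite_field" where "g \<noteq> 0" "\<And>x. x \<noteq> 0 \<Longrightarrow> \<exists>i::nat. x = g ^ i"
proof -
  \<comment> \<open>The field type is repackaged as a ring record, so that cyclicity of the
    multiplicative group, known for finite fields given by a carrier, applies.\<close>
  define R :: "'a ring" where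
    "R = \<lparr>carrier = UNIV, monoid.mult = (*), one = 1, ring.zero = 0, add = (+)\<rparr>"
  have "\<exists>y. x + y = 0" for x :: 'a
    using add.right_inverse by blast
  moreover have "\<exists>y. x * y = 1" if "x \<noteq> 0" for x :: 'a
    using that by (intro exI[of _ "inverse x"]) simp
  ultimately interpret R: field R
    by unfold_locales (auto simp: R_def algebra_simps Units_def)
  have carrier: "carrier R = UNIV" and zero: "\<zero>\<^bsub>R\<^esub> = 0"
    by (simp_all add: R_def)
  have pow: "x [^]\<^bsub>R\<^esub> i = x ^ i" for x and i :: nat
    by (induction i) (simp_all add: R_def nat_pow_def mult.commute)
  have "\<exists>a\<in>carrier (mult_of R). carrier (mult_of R) = {a [^]\<^bsub>R\<^esub> i |i::nat. i \<in> UNIV}"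
    by (rule R.finite_field_mult_group_has_gen) (simp add: carrier)
  then obtain g where "g \<in> carrier (mult_of R)"
    and "carrier (mult_of R) = {g [^]\<^bsub>R\<^esub> i |i::nat. i \<in> UNIV}"
    by blast
  then have g: "g \<noteq> 0" "UNIV - {0} = {g ^ i |i::nat. i \<in> UNIV}"
    by (simp_all add: carrier zero pow carrier_mult_of)
  show thesis
    by (rule that[of g]) (use g in auto)
qed

text \<open>No trace map is used: as an additive group the field is split into the multiples of 1
  and a complement \<open>H\<close>, and the component along 1 becomes the exponent of a primitive
  p-th root of unity.\<close>

lemma exists_additive_character:
  obtains psi :: "'a::finite_field \<Rightarrow> complex"
  where "\<And>x y. psi (x + y) = psi x * psi y" "\<And>x. cmod (psi x) = 1" "psi 1 \<noteq> 1"
proof -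
  define p where "p = CHAR('a)"
  have p: "prime p"
    by (simp add: p_def prime_CHAR_semidom)
  \<comment> \<open>In characteristic \<open>p\<close> closure under addition already gives
    negatives, because -x = (p - 1) x.\<close>
  define sub where "sub = (\<lambda>H :: 'a set. 0 \<in> H \<and> (\<forall>x\<in>H. \<forall>y\<in>H. x + y \<in> H))"
  have mult: "of_nat c * x \<in> H" if "sub H" "x \<in> H" for c x H
    using that by (induction c) (auto simp: sub_def algebra_simps)
  have neg: "- x \<in> H" if "sub H" "x \<in> H" for x H
  proof -
    have "of_nat (p - 1) = of_nat p - (1::'a)"
      using prime_ge_1_nat[OF p] by (subst of_nat_diff) simp_all
    then have "- x = of_nat (p - 1) * x"
      by (simp add: p_def)
    then show ?thesis
      using mult[OF that] by simp
  qed
  have diff: "x - y \<in> H" if "sub H" "x \<in> H" "y \<in> H" for x y H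
    using neg[OF that(1,3)] that unfolding sub_def by (metis add_uminus_conv_diff)
  have inverse_mod: "\<exists>d. of_nat d * of_nat c = (1::'a)" if "\<not> p dvd c" for c
  proof -
    have "coprime c p"
      using p that by (metis coprime_commute prime_imp_coprime)
    then obtain d where "[c * d = 1] (mod p)"
      by (metis One_nat_def cong_solve_coprime_nat)
    then have "of_nat (c * d) = (of_nat 1 :: 'a)"
      unfolding of_nat_eq_iff_cong_CHAR p_def .
    then show ?thesis
      by (intro exI[of _ d]) (simp add: mult.commute)
  qed
  \<comment> \<open>A subgroup maximal among those avoiding 1 has the multiples of 1 as a complement.\<close>
  have ex: "\<exists>H. sub H \<and> 1 \<notin> H"
    by (intro exI[of _ "{0}"]) (auto simp: sub_def)
  obtain H where H: "sub H" "1 \<notin> H" and max: "\<And>K. sub K \<Longrightarrow> 1 \<notin> K \<Longrightarrow> H \<subseteq> K \<Longrightarrow> K = H"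
  proof -
    have "finite {H. sub H \<and> 1 \<notin> H}" "{H. sub H \<and> 1 \<notin> H} \<noteq> {}"
      using ex by auto
    from finite_has_maximal[OF this] show ?thesis
      using that by blast
  qed
  have dvdI: "p dvd c" if c: "of_nat c \<in> H" for c
  proof (rule ccontr)
    assume "\<not> p dvd c"
    then obtain d where "of_nat d * of_nat c = (1::'a)"
      using inverse_mod by blast
    then show False
      using mult[OF H(1) c, of d] H(2) by simp
  qed
  have decomp: "\<exists>c. x - of_nat c \<in> H" for x
  proof (cases "x \<in> H")
    case True
    then show ?thesis by (intro exI[of _ 0]) simp
  next
    case False
    \<comment> \<open>For \<open>x\<close> outside \<open>H\<close>, adjoining \<open>x\<close>
      gives a strictly larger subgroup, which must contain 1 by maximality. Solving 1 = h + c x for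
      \<open>x\<close> shows that \<open>x\<close> is a multiple of 1 modulo
      \<open>H\<close>.\<close>
    define K where "K = {h + of_nat c * x |h c. h \<in> H}"
    have "sub K"
    proof -
      have "0 \<in> K"
        using H(1) unfolding K_def sub_def by (auto intro!: exI[of _ 0])
      moreover have "u + v \<in> K" if "u \<in> K" "v \<in> K" for u v
      proof -
        from that obtain h c h' c' where "h \<in> H" "h' \<in> H" "u = h + of_nat c * x" "v = h' + of_nat c' * x"
          unfolding K_def by auto
        then have "h + h' \<in> H" "u + v = (h + h') + of_nat (c + c') * x"
          using H(1) by (auto simp: sub_def algebra_simps)
        then show ?thesis
          unfolding K_def by blast
      qed
      ultimately show ?thesis
        by (auto simp: sub_def)
    qed
    moreover have "H \<subseteq> K"
    proof
      fix h assume "h \<in> H"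
      moreover have "h = h + of_nat 0 * x" by simp
      ultimately show "h \<in> K" unfolding K_def by blast
    qed
    moreover have "x \<in> K"
    proof -
      have "0 \<in> H" "x = 0 + of_nat 1 * x"
        using H(1) by (simp_all add: sub_def)
      then show ?thesis unfolding K_def by blast
    qed
    ultimately have "1 \<in> K"
      using max[of K] False by auto
    then obtain h c where hc: "h \<in> H" "1 = h + of_nat c * x"
      unfolding K_def by auto
    have "\<not> p dvd c"
    proof
      assume "p dvd c"
      then have "of_nat c = (0::'a)"
        by (simp add: of_nat_eq_0_iff_char_dvd p_def)
      then show False
        using hc H(2) by simp
    qed
    then obtain d where d: "of_nat d * of_nat c = (1::'a)"
      using inverse_mod by blast
    have "of_nat c * x = 1 - h"
      unfolding hc(2) by simp
    then have "x = of_nat d * (1 - h)"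
      by (metis d mult.assoc mult_1)
    then have "x - of_nat d = - (of_nat d * h)"
      by (simp add: algebra_simps)
    then show ?thesis
      using neg[OF H(1) mult[OF H(1) hc(1)]] by (intro exI[of _ d]) simp
  qed
  \<comment> \<open>\<open>f x\<close> is an arbitrary representative; \<open>w_cong\<close> below
    makes \<open>w ^ f x\<close> independent of the choice, since two representatives differ by a
    multiple of \<open>p\<close>.\<close>
  define f where "f = (\<lambda>x. SOME c. x - of_nat c \<in> H)"
  have f: "x - of_nat (f x) \<in> H" for x
    unfolding f_def using decomp by (rule someI_ex)
  define w where "w = cis (2 * pi / p)"
  have w_p: "w ^ p = 1"
    unfolding w_def Complex.DeMoivre using prime_gt_0_nat[OF p] by simp
  have w_cong: "w ^ c = w ^ d" if "of_nat c - of_nat d \<in> H" for c d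
  proof -
    have *: "w ^ c = w ^ d" if "of_nat c - of_nat d \<in> H" and le: "d \<le> c" for c d
    proof -
      have "p dvd c - d"
        by (rule dvdI) (use that in \<open>simp add: of_nat_diff\<close>)
      then obtain r where "c = d + p * r"
        using le by (metis dvd_def le_add_diff_inverse)
      then show ?thesis
        by (simp add: power_add power_mult w_p)
    qed
    show ?thesis
    proof (cases "d \<le> c")
      case False
      have "of_nat d - of_nat c \<in> H"
        using neg[OF H(1) that] by simp
      then show ?thesis
        using *[of d c] False by simp
    qed (use * that in blast)
  qed
  show thesis
  proof (rule that[of "\<lambda>x. w ^ f x"])
    fix x y
    have "(x - of_nat (f x)) + (y - of_nat (f y)) - (x + y - of_nat (f (x + y))) \<in> H"
      by (intro diff[OF H(1) _ f]) (use H(1) f in \<open>auto simp: sub_def\<close>)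
    also have "(x - of_nat (f x)) + (y - of_nat (f y)) - (x + y - of_nat (f (x + y)))
        = of_nat (f (x + y)) - of_nat (f x + f y)"
      by simp
    finally show "w ^ f (x + y) = w ^ f x * w ^ f y"
      using w_cong by (simp flip: power_add)
  next
    show "cmod (w ^ f x) = 1" for x
      by (simp add: w_def norm_power)
  next
    have "of_nat (f 1) - of_nat 1 \<in> H"
      using neg[OF H(1) f[of 1]] by simp
    then have "w ^ f 1 = w"
      using w_cong[of "f 1" 1] by simp
    moreover have "w \<noteq> 1"
    proof
      assume "w = 1"
      then obtain i :: int where "2 * pi / p = of_int i * (2 * pi)"
        unfolding w_def by (auto simp: cis_eq_1_iff mult_ac)
      then have "(2 * pi) * (1 / real p) = (2 * pi) * of_int i"
        by simp
      then have "1 / real p = of_int i"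
        by (subst (asm) mult_cancel_left) simp
      moreover have "0 < 1 / real p" "1 / real p < 1"
        using prime_gt_1_nat[OF p] by auto
      ultimately show False by simp
    qed
    ultimately show "w ^ f 1 \<noteq> 1" by simp
  qed
qed

section \<open>Multiplicative characters of the field\<close>

locale finite_field_characters =
  fixes g :: "'a::finite_field" and psi :: "'a \<Rightarrow> complex"
  assumes g_nonzero: "g \<noteq> 0"
    and generator: "x \<noteq> 0 \<Longrightarrow> \<exists>i::nat. x = g ^ i"
    and psi_add: "psi (x + y) = psi x * psi y"
    and norm_psi: "cmod (psi x) = 1"
    and psi_1: "psi 1 \<noteq> 1"
begin

lemma card_ge_2: "CARD('a) \<ge> 2"
proof -
  have "card {0, 1 :: 'a} \<le> CARD('a)"
    by (rule card_mono) auto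
  then show ?thesis by simp
qed

text \<open>The value is just \<open>CARD('a) - 1\<close>; the constant shields it from arithmetic simplification.\<close>

definition ordg :: nat where
  "ordg = card (range (\<lambda>i::nat. g ^ i))"

lemma ordg_eq: "ordg = CARD('a) - 1"
proof -
  have "range (\<lambda>i::nat. g ^ i) = UNIV - {0}"
    using generator g_nonzero by fastforce
  then show ?thesis
    by (simp add: ordg_def card_Diff_singleton)
qed

lemma ordg_pos [simp]: "ordg > 0" "ordg \<noteq> 0"
  using card_ge_2 by (simp_all add: ordg_eq)

lemma card_nonzero: "card (UNIV - {0::'a}) = ordg"
  by (simp add: ordg_eq card_Diff_singleton)

lemma generator_power_eq_1: "g ^ ordg = 1"
proof -
  have "g * g ^ ordg = g ^ CARD('a)"
    using card_ge_2 by (simp add: ordg_eq flip: power_Suc)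
  then show ?thesis
    using g_nonzero by (simp add: finite_field_power_card_eq_same)
qed

lemma generator_power_mod: "g ^ (i mod ordg) = g ^ i"
proof -
  have "g ^ i = g ^ (ordg * (i div ordg) + i mod ordg)"
    by simp
  also have "\<dots> = g ^ (i mod ordg)"
    unfolding power_add power_mult generator_power_eq_1 by simp
  finally show ?thesis ..
qed

lemma bij_betw_generator_power: "bij_betw (\<lambda>i. g ^ i) {..<ordg} (UNIV - {0})"
proof -
  have image: "(\<lambda>i. g ^ i) ` {..<ordg} = UNIV - {0}"
  proof (intro equalityI subsetI)
    fix x assume "x \<in> UNIV - {0::'a}"
    then obtain i where "x = g ^ i"
      using generator by auto
    then have "x = g ^ (i mod ordg)"
      by (simp only: generator_power_mod)
    then show "x \<in> (\<lambda>i. g ^ i) ` {..<ordg}"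
      by auto
  qed (use g_nonzero in auto)
  moreover have "inj_on (\<lambda>i. g ^ i) {..<ordg}"
    by (rule eq_card_imp_inj_on) (simp_all add: image card_nonzero)
  ultimately show ?thesis
    by (simp add: bij_betw_def)
qed

definition dlog :: "'a \<Rightarrow> nat" where
  "dlog = the_inv_into {..<ordg} (\<lambda>i. g ^ i)"

text \<open>Powers of the character that sends \<open>g\<close> to a primitive root of unity of
  order \<open>ordg\<close>. All vanish at 0, the trivial one included, so \<open>chi 0\<close> is
  the indicator of the nonzero elements. Integer indices allow \<open>chi (- j)\<close> for the
  conjugate.\<close>

definition chi :: "int \<Rightarrow> 'a \<Rightarrow> complex" where
  "chi j x = (if x = 0 then 0 else cis (2 * pi * of_int j * dlog x / ordg))"

lemma dlog_generator_power: "dlog (g ^ i) = i mod ordg"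
proof -
  have "dlog (g ^ (i mod ordg)) = i mod ordg"
    unfolding dlog_def using bij_betw_generator_power
    by (intro the_inv_into_f_f) (auto simp: bij_betw_def)
  then show ?thesis
    by (simp only: generator_power_mod)
qed

lemma cis_index_eq_1_iff: "cis (2 * pi * of_int j / ordg) = 1 \<longleftrightarrow> int ordg dvd j"
proof
  assume "cis (2 * pi * of_int j / ordg) = 1"
  then obtain i :: int where "2 * pi * of_int j / ordg = of_int i * (2 * pi)"
    by (auto simp: cis_eq_1_iff mult_ac)
  then have "(2 * pi) * of_int j = (2 * pi) * (of_int i * real ordg)"
    by (simp add: field_simps)
  then have "of_int j = of_int i * real ordg"
    by (subst (asm) mult_cancel_left) simp
  then have "j = i * int ordg"
    by (metis of_int_eq_iff of_int_mult of_int_of_nat_eq)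
  then show "int ordg dvd j"
    by simp
next
  assume "int ordg dvd j"
  then obtain i where i: "j = int ordg * i" ..
  have "2 * pi * of_int j / ordg = 2 * pi * of_int i"
    unfolding i by (simp add: field_simps)
  then show "cis (2 * pi * of_int j / ordg) = 1"
    by (simp only: cis_multiple_2pi Ints_of_int)
qed

lemma chi_generator_power: "chi j (g ^ i) = cis (2 * pi * of_int (j * int i) / ordg)"
proof -
  define r s where "r = i mod ordg" and "s = i div ordg"
  have i: "i = ordg * s + r"
    by (simp add: r_def s_def)
  have "cis (2 * pi * of_int (j * int i) / ordg)
      = cis (2 * pi * of_int (int ordg * (j * int s)) / ordg + 2 * pi * of_int j * r / ordg)"
    unfolding i by (simp add: algebra_simps add_divide_distrib)
  also have "\<dots> = cis (2 * pi * of_int j * r / ordg)"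
    unfolding cis_mult[symmetric] using cis_index_eq_1_iff[of "int ordg * (j * int s)"]
    by simp
  also have "\<dots> = chi j (g ^ i)"
    using g_nonzero by (simp add: chi_def dlog_generator_power r_def)
  finally show ?thesis ..
qed

lemma chi_0_right [simp]: "chi j 0 = 0"
  by (simp add: chi_def)

lemma chi_1_right [simp]: "chi j 1 = 1"
  using chi_generator_power[of j 0] by simp

lemma chi_0_left: "chi 0 x = of_bool (x \<noteq> 0)"
  by (simp add: chi_def)

lemma chi_mult: "chi j (x * y) = chi j x * chi j y"
proof (cases "x = 0 \<or> y = 0")
  case False
  then obtain i i' where "x = g ^ i" "y = g ^ i'"
    using generator by blast
  then show ?thesis
    by (simp add: chi_generator_power cis_mult add_divide_distrib algebra_simps flip: power_add)
qed auto

lemma chi_prod: "finite I \<Longrightarrow> chi j (\<Prod>i\<in>I. f i) = (\<Prod>i\<in>I. chi j (f i))"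
  by (induction I rule: finite_induct) (simp_all add: chi_mult)

lemma chi_add: "chi (j + j') x = chi j x * chi j' x"
  by (simp add: chi_def cis_mult add_divide_distrib algebra_simps)

text \<open>Positivity of \<open>m\<close> matters at \<open>x = 0\<close>, where
  \<open>x ^ 0 = 1\<close> but \<open>chi 0 0 = 0\<close>.\<close>

lemma chi_power_right: "m > 0 \<Longrightarrow> chi j (x ^ m) = chi (j * int m) x"
proof (induction m rule: nat_induct_non_zero)
  case (Suc m)
  then show ?case
    by (simp add: chi_mult chi_add algebra_simps)
qed simp

lemma cnj_chi: "cnj (chi j x) = chi (- j) x"
  by (simp add: chi_def cis_cnj)

lemma norm_chi: "cmod (chi j x) = of_bool (x \<noteq> 0)"
  by (simp add: chi_def)

lemma chi_index_dvd:
  assumes "int ordg dvd j"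
  shows "chi j x = chi 0 x"
proof (cases "x = 0")
  case False
  then obtain i where "x = g ^ i"
    using generator by blast
  moreover have "int ordg dvd j * int i"
    using assms by simp
  ultimately show ?thesis
    by (simp only: chi_generator_power cis_index_eq_1_iff[symmetric]) simp
qed simp

lemma chi_minus_mult_chi: "x \<noteq> 0 \<Longrightarrow> chi (- j) x * chi j x = 1"
  by (simp add: chi_0_left flip: chi_add)

lemma chi_inverse: "chi j (inverse x) = chi (- j) x"
proof (cases "x = 0")
  case False
  have "chi j (inverse x) * chi j x = 1"
    using False by (simp flip: chi_mult)
  with chi_minus_mult_chi[OF False, of j] show ?thesis
    by (metis mult_cancel_right mult_zero_right zero_neq_one)
qed simp

text \<open>Replacing \<open>x\<close> by \<open>g * x\<close> permutes the field and multiplies the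
  sum by \<open>chi j g\<close>, which differs from 1 for a nontrivial character.\<close>

lemma sum_chi:
  "(\<Sum>x\<in>UNIV. chi j x) = (if int ordg dvd j then of_nat ordg else 0)"
proof (cases "int ordg dvd j")
  case True
  have "(\<Sum>x\<in>UNIV. chi j x) = (\<Sum>x\<in>UNIV - {0::'a}. 1)"
    by (subst sum.mono_neutral_cong_right[where S = "UNIV - {0}" and h = "\<lambda>_. 1"])
       (auto simp: chi_index_dvd[OF True] chi_0_left)
  then show ?thesis
    using True by (simp only: sum_constant card_nonzero) simp
next
  case False
  have "chi j g * (\<Sum>x\<in>UNIV. chi j x) = (\<Sum>x\<in>UNIV. chi j (g * x))"
    by (simp add: chi_mult sum_distrib_left)
  also have "\<dots> = (\<Sum>x\<in>UNIV. chi j x)"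
    by (rule sum.reindex_bij_witness[of _ "\<lambda>x. x / g" "\<lambda>x. g * x"]) (use g_nonzero in auto)
  finally have "chi j g = 1 \<or> (\<Sum>x\<in>UNIV. chi j x) = 0"
    by auto
  moreover have "chi j g \<noteq> 1"
    using False chi_generator_power[of j 1] cis_index_eq_1_iff[of j] by simp
  ultimately show ?thesis
    using False by simp
qed

text \<open>Dual orthogonality: for nonzero \<open>x\<close> this is a geometric sum whose ratio is
  a root of unity of order dividing \<open>ordg\<close>, equal to 1 only for
  \<open>x = 1\<close>.\<close>

lemma sum_chi_index:
  "(\<Sum>j<ordg. chi (int j) x) = (if x = 1 then of_nat ordg else 0)"
proof (cases "x = 0")
  case False
  define i where "i = dlog x"
  have x: "x = g ^ i" "i < ordg"
  proof -
    obtain i' where "x = g ^ i'"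
      using False generator by blast
    then show "x = g ^ i" "i < ordg"
      by (simp_all add: i_def dlog_generator_power generator_power_mod)
  qed
  define w where "w = cis (2 * pi * of_int (int i) / ordg)"
  have w_1: "w = 1 \<longleftrightarrow> x = 1"
  proof
    assume "w = 1"
    then have "int ordg dvd int i"
      unfolding w_def cis_index_eq_1_iff .
    with x show "x = 1"
      by (auto dest: nat_dvd_not_less)
  next
    assume "x = 1"
    then have "i = 0"
      using dlog_generator_power[of 0] by (simp add: i_def)
    then show "w = 1"
      by (simp add: w_def)
  qed
  have chi: "chi (int j) x = w ^ j" for j
    unfolding x(1) chi_generator_power w_def Complex.DeMoivre by (simp add: algebra_simps)
  have "w ^ ordg = 1"
    unfolding w_def Complex.DeMoivre using cis_index_eq_1_iff[of "int ordg * int i"]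
    by (simp add: algebra_simps)
  then show ?thesis
    unfolding chi using w_1 by (auto simp: geometric_sum)
qed simp

section \<open>The additive character and Gauss sums\<close>

lemma psi_0 [simp]: "psi 0 = 1"
proof -
  have "psi 0 * psi 0 = psi 0" "psi 0 \<noteq> 0"
    using psi_add[of 0 0] norm_psi[of 0] by auto
  then show ?thesis by simp
qed

lemma psi_sum: "finite I \<Longrightarrow> psi (\<Sum>i\<in>I. f i) = (\<Prod>i\<in>I. psi (f i))"
  by (induction I rule: finite_induct) (simp_all add: psi_add)

lemma cnj_psi: "cnj (psi x) = psi (- x)"
proof -
  have "psi x * psi (- x) = 1" "psi x * cnj (psi x) = 1"
    using psi_add[of x "- x"] norm_psi[of x] by (simp_all add: complex_mult_cnj cmod_def)
  then show ?thesis
    by (metis mult_cancel_left mult_zero_left zero_neq_one)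
qed

text \<open>Scaling reduces to the sum of \<open>psi\<close> itself, which translation by 1
  multiplies by \<open>psi 1\<close>, a number different from 1.\<close>

lemma sum_psi: "(\<Sum>x\<in>UNIV. psi (x * c)) = (if c = 0 then of_nat CARD('a) else 0)"
proof (cases "c = 0")
  case False
  have "(\<Sum>x\<in>UNIV. psi (x * c)) = (\<Sum>x\<in>UNIV. psi x)"
    by (rule sum.reindex_bij_witness[of _ "\<lambda>x. x / c" "\<lambda>x. x * c"]) (use False in auto)
  moreover have "psi 1 * (\<Sum>x\<in>UNIV. psi x) = (\<Sum>x\<in>UNIV. psi (1 + x))"
    by (simp add: psi_add sum_distrib_left)
  moreover have "(\<Sum>x\<in>UNIV. psi (1 + x)) = (\<Sum>x\<in>UNIV. psi x)"
    by (rule sum.reindex_bij_witness[of _ "\<lambda>x. x - 1" "\<lambda>x. 1 + x"]) auto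
  ultimately show ?thesis
    using False psi_1 by auto
qed simp

lemma sum_chi_0_psi: "(\<Sum>t\<in>UNIV. chi 0 t * psi (t * s)) = of_nat CARD('a) * of_bool (s = 0) - 1"
proof -
  have "(\<Sum>t\<in>UNIV. chi 0 t * psi (t * s)) = (\<Sum>t\<in>UNIV. psi (t * s) - of_bool (t = 0))"
    by (rule sum.cong) (auto simp: chi_0_left)
  then show ?thesis
    by (simp add: sum_subtractf sum_psi)
qed

definition gauss :: "int \<Rightarrow> complex" where
  "gauss j = (\<Sum>x\<in>UNIV. chi j x * psi x)"

lemma sum_chi_psi:
  assumes "c \<noteq> 0"
  shows "(\<Sum>x\<in>UNIV. chi j x * psi (x * c)) = chi (- j) c * gauss j"
proof -
  have "(\<Sum>x\<in>UNIV. chi j x * psi (x * c)) = (\<Sum>x\<in>UNIV. chi j (x * inverse c) * psi x)"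
    by (rule sum.reindex_bij_witness[of _ "\<lambda>x. x * inverse c" "\<lambda>x. x * c"])
       (use assms in \<open>auto simp: field_simps\<close>)
  then show ?thesis
    by (simp add: chi_mult chi_inverse gauss_def sum_distrib_left mult_ac)
qed

lemma gauss_dvd:
  assumes "int ordg dvd j"
  shows "gauss j = - 1"
  using sum_chi_0_psi[of 1] by (simp add: gauss_def chi_index_dvd[OF assms])

text \<open>In the product of the Gauss sum G with its conjugate, each
  \<open>chi (- j) y * gauss j\<close> is rewritten as a sum of
  \<open>chi j u * psi (u * y)\<close>. Summing over nonzero \<open>y\<close> first gives q - 1 at
  \<open>u = 1\<close> and -1 elsewhere; the constant -1 meets the vanishing sum of
  \<open>chi j\<close>, leaving |G|^2 = q.\<close>

lemma norm_gauss:
  assumes "\<not> int ordg dvd j"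
  shows "cmod (gauss j) = sqrt CARD('a)"
proof -
  have inner: "chi (- j) y * psi (- y) * gauss j = (\<Sum>u\<in>UNIV. chi 0 y * (chi j u * psi (y * (u - 1))))" for y
  proof (cases "y = 0")
    case False
    have "psi (y * (u - 1)) = psi (- y) * psi (u * y)" for u
      using psi_add[of "- y" "u * y"] by (simp add: algebra_simps)
    moreover have "psi (- y) * (chi (- j) y * gauss j) = psi (- y) * (\<Sum>u\<in>UNIV. chi j u * psi (u * y))"
      using sum_chi_psi[OF False] by simp
    ultimately show ?thesis
      using False by (simp add: sum_distrib_left chi_0_left mult_ac)
  qed simp
  have "complex_of_real ((cmod (gauss j))\<^sup>2) = cnj (gauss j) * gauss j"
    by (subst complex_norm_square) (simp add: mult.commute)
  also have "\<dots> = (\<Sum>y\<in>UNIV. chi (- j) y * psi (- y) * gauss j)"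
    by (simp add: gauss_def sum_distrib_right cnj_chi cnj_psi)
  also have "\<dots> = (\<Sum>u\<in>UNIV. \<Sum>y\<in>UNIV. chi 0 y * (chi j u * psi (y * (u - 1))))"
    unfolding inner by (rule sum.swap)
  also have "\<dots> = (\<Sum>u\<in>UNIV. chi j u * (\<Sum>y\<in>UNIV. chi 0 y * psi (y * (u - 1))))"
    by (simp add: sum_distrib_left mult_ac)
  also have "\<dots> = (\<Sum>u\<in>UNIV. (if u = 1 then of_nat CARD('a) else 0) - chi j u)"
    unfolding sum_chi_0_psi by (rule sum.cong) (auto simp: algebra_simps)
  also have "\<dots> = complex_of_real CARD('a)"
    using assms by (simp add: sum_subtractf sum_chi)
  finally have "(cmod (gauss j))\<^sup>2 = CARD('a)"
    by (simp only: of_real_eq_iff)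
  then show ?thesis
    by (metis norm_ge_zero real_sqrt_unique)
qed

lemma norm_gauss_le: "cmod (gauss j) \<le> sqrt CARD('a)"
  using norm_gauss[of j] gauss_dvd[of j] card_ge_2
  by (cases "int ordg dvd j") auto

text \<open>Fourier inversion on the multiplicative group: Gauss sums are the Fourier coefficients
  of \<open>psi\<close>, and summing over \<open>j\<close> selects \<open>y = u\<close>.\<close>

lemma psi_eq_sum_gauss:
  assumes "u \<noteq> 0"
  shows "of_nat ordg * psi u = (\<Sum>j<ordg. gauss (int j) * chi (- int j) u)"
proof -
  have "(\<Sum>j<ordg. gauss (int j) * chi (- int j) u)
      = (\<Sum>j<ordg. \<Sum>y\<in>UNIV. psi y * chi (int j) (y * inverse u))"
    by (simp add: gauss_def sum_distrib_left sum_distrib_right chi_mult chi_inverse mult_ac)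
  also have "\<dots> = (\<Sum>y\<in>UNIV. psi y * (\<Sum>j<ordg. chi (int j) (y * inverse u)))"
    by (subst sum.swap) (simp add: sum_distrib_left)
  also have "\<dots> = (\<Sum>y\<in>UNIV. if y = u then psi y * of_nat ordg else 0)"
    unfolding sum_chi_index using assms by (intro sum.cong) (auto simp: field_simps)
  finally show ?thesis
    by (simp add: mult.commute)
qed

section \<open>Functions with bounded character expansions\<close>

text \<open>\<open>wiener B f\<close> says that \<open>f\<close> is a combination of multiplicative characters whose coefficients
  have absolute values summing to at most \<open>B\<close>; products multiply these bounds.\<close>

inductive wiener :: "real \<Rightarrow> ('a \<Rightarrow> complex) \<Rightarrow> bool" where
  zero: "B \<ge> 0 \<Longrightarrow> wiener B (\<lambda>_. 0)"
| add: "wiener B f \<Longrightarrow> wiener (B + cmod w) (\<lambda>x. f x + w * chi j x)"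

lemma wiener_nonneg: "wiener B f \<Longrightarrow> B \<ge> 0"
  by (induction rule: wiener.induct) auto

lemma wiener_mono: "wiener B f \<Longrightarrow> B \<le> C \<Longrightarrow> wiener C f"
proof (induction arbitrary: C rule: wiener.induct)
  case (add B f w j)
  \<comment> \<open>The slack is passed down to the zero function, whose rule accepts any
    nonnegative bound.\<close>
  have "wiener ((C - cmod w) + cmod w) (\<lambda>x. f x + w * chi j x)"
    using add by (intro wiener.add) auto
  then show ?case by simp
qed (auto intro: wiener.zero)

lemma wiener_chi_mult: "wiener B f \<Longrightarrow> wiener (cmod w * B) (\<lambda>x. w * chi j x * f x)"
proof (induction rule: wiener.induct)
  case (add B f v i)
  have "wiener (cmod w * B + cmod (w * v)) (\<lambda>x. w * chi j x * f x + w * v * chi (j + i) x)"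
    by (intro wiener.add add.IH)
  moreover have "w * chi j x * f x + w * v * chi (j + i) x = w * chi j x * (f x + v * chi i x)" for x
    by (simp add: chi_add algebra_simps)
  ultimately show ?case
    by (simp add: norm_mult distrib_left)
qed (auto intro: wiener.zero)

lemma wiener_add:
  assumes "wiener B f" "wiener C h"
  shows "wiener (B + C) (\<lambda>x. f x + h x)"
  using assms(2)
proof (induction rule: wiener.induct)
  case (zero C)
  then show ?case
    using wiener_mono[OF assms(1), of "B + C"] by simp
next
  case (add C h w j)
  then show ?case
    using wiener.add[OF add.IH, of w j] by (simp add: add_ac)
qed

lemma wiener_mult:
  assumes "wiener B f" "wiener C h"
  shows "wiener (B * C) (\<lambda>x. f x * h x)"
  using assms(1)
proof (induction rule: wiener.induct)
  case (zero B)
  then show ?case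
    using wiener_nonneg[OF assms(2)] by (auto intro: wiener.zero)
next
  case (add B f w j)
  have "wiener (B * C + cmod w * C) (\<lambda>x. f x * h x + w * chi j x * h x)"
    by (intro wiener_add add.IH wiener_chi_mult assms(2))
  then show ?case
    by (simp add: distrib_right)
qed

lemma wiener_chi: "wiener 1 (chi j)"
  using wiener.add[OF wiener.zero[of 0], of 1 j] by simp

text \<open>Combinations of characters vanish at 0, so each factor is only required to be one after
  multiplication by \<open>chi 0\<close>; the outer \<open>chi j\<close> removes the value of the
  product at 0 anyway.\<close>

lemma wiener_prod:
  assumes "finite I" "\<And>i. i \<in> I \<Longrightarrow> wiener B (\<lambda>x. chi 0 x * f i x)"
  shows "wiener (B ^ card I) (\<lambda>x. chi j x * (\<Prod>i\<in>I. f i x))"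
  using assms
proof (induction I rule: finite_induct)
  case empty
  then show ?case
    using wiener_chi by simp
next
  case (insert i I)
  have "wiener (B * B ^ card I) (\<lambda>x. chi 0 x * f i x * (chi j x * (\<Prod>i\<in>I. f i x)))"
    by (intro wiener_mult insert) (use insert in auto)
  moreover have "chi 0 x * f i x * (chi j x * (\<Prod>i\<in>I. f i x)) = chi j x * (\<Prod>i\<in>insert i I. f i x)" for x
    using insert by (cases "x = 0") (simp_all add: chi_0_left mult_ac)
  ultimately show ?case
    using insert by simp
qed

lemma wiener_sum:
  fixes B :: real
  assumes "finite J" "\<And>j. j \<in> J \<Longrightarrow> cmod (w j) \<le> B"
  shows "wiener (card J * B) (\<lambda>x. \<Sum>j\<in>J. w j * chi (r j) x)"
  using assms
proof (induction J rule: finite_induct)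
  case (insert j J)
  have "wiener (card J * B + cmod (w j)) (\<lambda>x. (\<Sum>j\<in>J. w j * chi (r j) x) + w j * chi (r j) x)"
    by (intro wiener.add insert) (use insert in auto)
  then have "wiener (card J * B + B) (\<lambda>x. (\<Sum>j\<in>J. w j * chi (r j) x) + w j * chi (r j) x)"
    by (rule wiener_mono) (use insert in auto)
  then show ?case
    using insert by (simp add: algebra_simps)
qed (auto intro: wiener.zero)

text \<open>Each character in the expansion contributes a Gauss sum, of modulus at most
  \<surd>q.\<close>

lemma wiener_sum_psi:
  assumes "wiener B f" "a \<noteq> 0"
  shows "cmod (\<Sum>x\<in>UNIV. f x * psi (x * a)) \<le> B * sqrt CARD('a)"
  using assms(1)
proof (induction rule: wiener.induct)
  case (add B f w j)
  have "(\<Sum>x\<in>UNIV. (f x + w * chi j x) * psi (x * a))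
      = (\<Sum>x\<in>UNIV. f x * psi (x * a)) + w * (chi (- j) a * gauss j)"
    unfolding sum_chi_psi[OF assms(2), symmetric]
    by (simp add: algebra_simps sum.distrib sum_distrib_left)
  moreover have "cmod (w * (chi (- j) a * gauss j)) \<le> cmod w * sqrt CARD('a)"
    using norm_gauss_le[of j] assms(2) by (simp add: norm_mult norm_chi mult_left_mono)
  ultimately show ?case
    using add.IH norm_triangle_mono by (fastforce simp: distrib_right)
qed simp

section \<open>One-variable power sums and their products\<close>

text \<open>The congruence fixes the remainder of \<open>j * m\<close> modulo \<open>ordg\<close>,
  so \<open>j\<close> is determined by the quotient \<open>j * m div ordg\<close>, which is below
  \<open>m\<close>.\<close>

lemma card_index_dvd_le:
  assumes "m > 0"
  shows "card {j. j < ordg \<and> int ordg dvd l - int j * int m} \<le> m"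
proof -
  let ?J = "{j. j < ordg \<and> int ordg dvd l - int j * int m}"
  have "card ?J \<le> card {..<m}"
  proof (rule card_inj_on_le)
    show "inj_on (\<lambda>j. j * m div ordg) ?J"
    proof (rule inj_onI)
      fix i j assume ij: "i \<in> ?J" "j \<in> ?J" "i * m div ordg = j * m div ordg"
      have "int i * int m mod int ordg = int j * int m mod int ordg"
        using ij by (metis (mono_tags, lifting) mem_Collect_eq mod_eq_dvd_iff)
      then have "i * m mod ordg = j * m mod ordg"
        by (metis of_nat_eq_iff of_nat_mod of_nat_mult)
      then have "i * m = j * m"
        using ij(3) by (metis div_mult_mod_eq)
      then show "i = j"
        using assms by simp
    qed
    show "(\<lambda>j. j * m div ordg) ` ?J \<subseteq> {..<m}"
      using assms by (auto simp: div_less_iff_less_mult mult.commute)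
  qed simp
  then show ?thesis by simp
qed

text \<open>Expanding \<open>psi\<close> in multiplicative characters leaves only those whose \<open>m\<close>-th power is \<open>chi l\<close>.
  For \<open>e = 1\<close>, \<open>l = 0\<close> the added constant cancels the trivial one, as \<open>gauss 0 = - 1\<close>.\<close>

lemma wiener_power_sum:
  assumes "m > 0" "c \<noteq> 0" and e: "e = 0 \<or> e = 1 \<and> l = 0"
  shows "wiener (m * sqrt CARD('a))
    (\<lambda>t. chi 0 t * (\<Sum>y\<in>UNIV. (chi l y + e * of_bool (y = 0)) * psi (t * (c * y ^ m))))"
proof -
  define J where "J = {j. j < ordg \<and> int ordg dvd l - int j * int m}"
  define w where "w = (\<lambda>j. gauss (int j) * chi (- int j) c + e * of_bool (j = 0))"
  have "chi 0 t * (\<Sum>y\<in>UNIV. (chi l y + e * of_bool (y = 0)) * psi (t * (c * y ^ m)))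
      = (\<Sum>j\<in>J. w j * chi (- int j) t)" for t
  proof (cases "t = 0")
    case False
    have "of_nat ordg * (\<Sum>y\<in>UNIV. chi l y * psi (t * (c * y ^ m)))
        = (\<Sum>y\<in>UNIV. \<Sum>j<ordg. chi l y * (gauss (int j) * chi (- int j) (t * (c * y ^ m))))"
      (is "?T = _")
      unfolding sum_distrib_left
    proof (rule sum.cong)
      fix y :: 'a
      show "of_nat ordg * (chi l y * psi (t * (c * y ^ m)))
        = (\<Sum>j<ordg. chi l y * (gauss (int j) * chi (- int j) (t * (c * y ^ m))))"
      proof (cases "y = 0")
        case y: False
        then have "of_nat ordg * psi (t * (c * y ^ m))
            = (\<Sum>j<ordg. gauss (int j) * chi (- int j) (t * (c * y ^ m)))"
          using False assms by (intro psi_eq_sum_gauss) auto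
        then show ?thesis
          by (simp flip: sum_distrib_left add: mult.left_commute)
      qed simp
    qed simp
    also have "\<dots> = (\<Sum>y\<in>UNIV. \<Sum>j<ordg.
        gauss (int j) * chi (- int j) c * chi (- int j) t * chi (l - int j * int m) y)"
      using assms(1) by (simp add: chi_mult chi_power_right chi_add mult_ac diff_conv_add_uminus
          del: add_uminus_conv_diff)
    also have "\<dots> = (\<Sum>j<ordg. gauss (int j) * chi (- int j) c * chi (- int j) t
        * (\<Sum>y\<in>UNIV. chi (l - int j * int m) y))"
      by (subst sum.swap) (simp add: sum_distrib_left)
    also have "\<dots> = (\<Sum>j\<in>J. gauss (int j) * chi (- int j) c * chi (- int j) t * of_nat ordg)"
      by (rule sum.mono_neutral_cong_right) (auto simp: J_def sum_chi)
    also have "\<dots> = of_nat ordg * (\<Sum>j\<in>J. gauss (int j) * chi (- int j) c * chi (- int j) t)"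
      by (simp add: sum_distrib_left mult_ac)
    finally have T: "(\<Sum>y\<in>UNIV. chi l y * psi (t * (c * y ^ m)))
        = (\<Sum>j\<in>J. gauss (int j) * chi (- int j) c * chi (- int j) t)"
      by simp
    \<comment> \<open>The extra weight at \<open>y = 0\<close> contributes the constant
      \<open>e\<close>, which for nonzero \<open>t\<close> equals \<open>e * chi 0 t\<close> and so
      joins the term \<open>j = 0\<close>.\<close>
    have "(\<Sum>y\<in>UNIV. e * of_bool (y = 0) * psi (t * (c * y ^ m))) = e"
      using assms(1) by (subst sum.remove[of _ 0]) (auto simp: power_0_left)
    moreover have "(\<Sum>j\<in>J. e * of_bool (j = 0) * chi (- int j) t) = e"
    proof (cases "e = 0")
      case True
      then show ?thesis by simp
    next
      case e1: False
      have "(0::nat) \<in> J" "finite J"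
        using e e1 by (auto simp: J_def)
      then show ?thesis
        using False by (subst sum.remove[of _ 0]) (auto simp: chi_0_left)
    qed
    ultimately show ?thesis
      using False T by (simp add: chi_0_left w_def distrib_right sum.distrib)
  qed simp
  moreover have "wiener (card J * sqrt CARD('a)) (\<lambda>t. \<Sum>j\<in>J. w j * chi (- int j) t)"
  proof (rule wiener_sum)
    fix j
    show "cmod (w j) \<le> sqrt CARD('a)"
    proof (cases "e = 1 \<and> j = 0")
      case True
      then show ?thesis
        using assms(2) by (simp add: w_def gauss_dvd chi_0_left)
    next
      case False
      then have "w j = gauss (int j) * chi (- int j) c"
        using e by (auto simp: w_def)
      then show ?thesis
        using norm_gauss_le[of "int j"] assms(2) by (simp add: norm_mult norm_chi)
    qed
  qed (simp add: J_def)
  moreover have "card J * sqrt CARD('a) \<le> m * sqrt CARD('a)"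
    using card_index_dvd_le[OF assms(1), of l] by (simp add: J_def mult_right_mono)
  ultimately show ?thesis
    using wiener_mono by simp
qed

text \<open>For fixed \<open>t\<close> the sum over \<open>x\<close> factors into one-variable sums,
  each costing m \<surd>q; the remaining sum against \<open>psi (t * a)\<close> costs one more
  \<surd>q, using that \<open>a\<close> is nonzero. The choice \<open>e = 0\<close> gives weights
  \<open>chi l\<close>, while \<open>e = 1\<close>, \<open>l = 0\<close> gives weight 1
  everywhere.\<close>

lemma twisted_sum_le:
  fixes c :: "'i \<Rightarrow> 'a" and a :: 'a
  assumes "finite I" "m > 0" "a \<noteq> 0" "\<And>i. i \<in> I \<Longrightarrow> c i \<noteq> 0" and e: "e = 0 \<or> e = 1 \<and> l = 0"
  shows "cmod (\<Sum>t\<in>UNIV. chi r t * (\<Sum>x\<in>I \<rightarrow>\<^sub>E UNIV.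
      (\<Prod>i\<in>I. chi l (x i) + e * of_bool (x i = 0)) * psi (t * ((\<Sum>i\<in>I. c i * x i ^ m) + a))))
    \<le> (m * sqrt CARD('a)) ^ card I * sqrt CARD('a)"
proof -
  define T where "T = (\<lambda>i t. \<Sum>y\<in>UNIV. (chi l y + e * of_bool (y = 0)) * psi (t * (c i * y ^ m)))"
  have "(\<Sum>x\<in>I \<rightarrow>\<^sub>E UNIV.
      (\<Prod>i\<in>I. chi l (x i) + e * of_bool (x i = 0)) * psi (t * ((\<Sum>i\<in>I. c i * x i ^ m) + a)))
      = (\<Prod>i\<in>I. T i t) * psi (t * a)" for t
    unfolding T_def prod_sum_PiE[OF assms(1) finite] prod.distrib sum_distrib_right
    by (rule sum.cong)
       (simp_all add: distrib_left psi_add sum_distrib_left psi_sum[OF assms(1)] mult_ac)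
  then have "(\<Sum>t\<in>UNIV. chi r t * (\<Sum>x\<in>I \<rightarrow>\<^sub>E UNIV.
      (\<Prod>i\<in>I. chi l (x i) + e * of_bool (x i = 0)) * psi (t * ((\<Sum>i\<in>I. c i * x i ^ m) + a))))
      = (\<Sum>t\<in>UNIV. (chi r t * (\<Prod>i\<in>I. T i t)) * psi (t * a))"
    by (simp add: mult_ac)
  moreover have "wiener ((m * sqrt CARD('a)) ^ card I) (\<lambda>t. chi r t * (\<Prod>i\<in>I. T i t))"
    using assms unfolding T_def by (intro wiener_prod wiener_power_sum) auto
  ultimately show ?thesis
    using wiener_sum_psi[OF _ assms(3)] by simp
qed

section \<open>Counting the solutions\<close>

text \<open>Zeros of \<open>f\<close> are detected by additive orthogonality; the term
  \<open>t = 0\<close> is split off as the plain sum of \<open>h\<close>.\<close>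

lemma sum_zeros_eq:
  assumes "finite X"
  shows "of_nat CARD('a) * (\<Sum>x\<in>X. h x * of_bool (f x = 0))
    = (\<Sum>x\<in>X. h x) + (\<Sum>t\<in>UNIV. chi 0 t * (\<Sum>x\<in>X. h x * psi (t * f x)))"
proof -
  have "(\<Sum>t\<in>UNIV. chi 0 t * (\<Sum>x\<in>X. h x * psi (t * f x)))
      = (\<Sum>x\<in>X. h x * (\<Sum>t\<in>UNIV. chi 0 t * psi (t * f x)))"
    unfolding sum_distrib_left by (subst sum.swap) (simp add: mult_ac)
  then show ?thesis
    unfolding sum_chi_0_psi by (simp add: algebra_simps sum_subtractf sum_distrib_left)
qed

lemma sum_chi_prod:
  assumes "finite I"
  shows "(\<Sum>x\<in>I \<rightarrow>\<^sub>E UNIV. chi l (\<Prod>i\<in>I. x i))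
    = (if int ordg dvd l then of_nat ordg else 0) ^ card I"
proof -
  have "(\<Sum>x\<in>I \<rightarrow>\<^sub>E UNIV. chi l (\<Prod>i\<in>I. x i)) = (\<Prod>i\<in>I. \<Sum>y\<in>UNIV. chi l y)"
    unfolding prod_sum_PiE[OF assms finite] chi_prod[OF assms] ..
  then show ?thesis
    by (simp add: sum_chi)
qed

lemma card_solutions_le:
  fixes c :: "'i \<Rightarrow> 'a" and a b :: 'a
  assumes "finite I" "I \<noteq> {}" "m > 0" "k > 0" "a \<noteq> 0" "b \<noteq> 0" "\<And>i. i \<in> I \<Longrightarrow> c i \<noteq> 0"
  shows "\<bar>real (card {x \<in> I \<rightarrow>\<^sub>E UNIV. ((\<Sum>i\<in>I. c i * x i ^ m) + a) ^ k = b * (\<Prod>i\<in>I. x i)})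
      - real CARD('a) ^ (card I - 1)\<bar> \<le> 4 * (m * sqrt CARD('a)) ^ card I"
proof -
  define P where "P = I \<rightarrow>\<^sub>E (UNIV :: 'a set)"
  define S where "S = (\<lambda>x. (\<Sum>i\<in>I. c i * x i ^ m) + a)"
  define Q where "Q = (\<lambda>x :: 'i \<Rightarrow> 'a. \<Prod>i\<in>I. x i)"
  define K where "K = (m * sqrt CARD('a)) ^ card I"
  define N where "N = card {x \<in> P. S x ^ k = b * Q x}"
  \<comment> \<open>\<open>A\<close> counts all zeros of \<open>S\<close>, \<open>M 0\<close> those
    with nonzero coordinates; \<open>E j\<close> is the contribution of \<open>chi j\<close>. The
    exponential sums \<open>z\<close> and \<open>Z\<close> express them and carry the error.\<close>
  define A where "A = (\<Sum>x\<in>P. of_bool (S x = 0) :: complex)"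
  define M where "M = (\<lambda>l. \<Sum>x\<in>P. chi l (Q x) * of_bool (S x = 0))"
  define E where "E = (\<lambda>j. \<Sum>x\<in>P. chi j (S x ^ k) * chi (- j) (b * Q x))"
  define z where "z = (\<Sum>t\<in>UNIV. chi 0 t * (\<Sum>x\<in>P. psi (t * S x)))"
  define Z where "Z = (\<lambda>r l. \<Sum>t\<in>UNIV. chi r t * (\<Sum>x\<in>P. chi l (Q x) * psi (t * S x)))"
  have fin: "finite P"
    unfolding P_def by (intro finite_PiE assms(1)) simp
  have cardP: "card P = CARD('a) ^ card I"
    using assms(1) by (simp add: P_def card_PiE)
  have q1: "1 \<le> sqrt CARD('a)" "sqrt CARD('a) \<le> CARD('a)" "CARD('a) = ordg + 1"
  proof -
    have "1 \<le> real CARD('a)"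
      using card_ge_2 by linarith
    then show "1 \<le> sqrt CARD('a)" "sqrt CARD('a) \<le> CARD('a)"
      by (simp_all add: real_le_lsqrt power2_eq_square)
    show "CARD('a) = ordg + 1"
      using card_ge_2 by (simp add: ordg_eq)
  qed
  have cardI: "card I > 0"
    using assms(1,2) by (simp add: card_gt_0_iff)
  have K0: "K \<ge> 0"
    by (simp add: K_def)

  have z_le: "cmod z \<le> K * sqrt CARD('a)"
  proof -
    have one: "chi 0 y + 1 * of_bool (y = 0) = 1" for y
      by (simp add: chi_0_left)
    show ?thesis
      using twisted_sum_le[OF assms(1,3,5,7), where e = 1 and l = 0 and r = 0]
      unfolding one by (simp add: z_def K_def P_def S_def)
  qed
  have Z_le: "cmod (Z r l) \<le> K * sqrt CARD('a)" for r l
    using twisted_sum_le[OF assms(1,3,5,7), where e = 0 and l = l and r = r]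
    by (simp add: Z_def K_def P_def S_def Q_def chi_prod[OF assms(1)])

  have A_eq: "of_nat CARD('a) * A = of_nat CARD('a) ^ card I + z"
    using sum_zeros_eq[OF fin, of "\<lambda>_. 1" S] by (simp add: A_def z_def cardP)
  have M_eq: "of_nat CARD('a) * M l = (if int ordg dvd l then of_nat ordg else 0) ^ card I + Z 0 l" for l
    using sum_zeros_eq[OF fin, of "\<lambda>x. chi l (Q x)" S] sum_chi_prod[OF assms(1), of l]
    by (simp add: M_def Z_def Q_def P_def)
  have E_0: "E 0 = of_nat ordg ^ card I - M 0"
  proof -
    have "E 0 = (\<Sum>x\<in>P. chi 0 (Q x) - chi 0 (Q x) * of_bool (S x = 0))"
      unfolding E_def using assms(4,6) by (intro sum.cong) (auto simp: chi_0_left)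
    then show ?thesis
      using sum_chi_prod[OF assms(1), of 0] by (simp add: sum_subtractf M_def Q_def P_def)
  qed
  have E_le: "cmod (E j) \<le> K" if j: "\<not> int ordg dvd j" for j
  proof (cases "int ordg dvd j * int k")
    \<comment> \<open>Here \<open>chi j (S x ^ k)\<close> is just the indicator of
      \<open>S x\<close> nonzero. As \<open>chi (- j)\<close> is nontrivial, its full sum vanishes
      and only the zeros of \<open>S\<close> remain.\<close>
    case True
    have "chi j (S x ^ k) * chi (- j) (b * Q x)
        = chi (- j) b * (chi (- j) (Q x) - chi (- j) (Q x) * of_bool (S x = 0))" for x
      unfolding chi_power_right[OF assms(4)] chi_index_dvd[OF True]
      by (simp add: chi_mult chi_0_left)
    then have "E j = chi (- j) b * ((\<Sum>x\<in>P. chi (- j) (Q x)) - M (- j))"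
      by (simp add: E_def M_def sum_subtractf flip: sum_distrib_left)
    also have "(\<Sum>x\<in>P. chi (- j) (Q x)) = 0"
      using sum_chi_prod[OF assms(1), of "- j"] j cardI by (simp add: P_def Q_def)
    finally have "cmod (E j) = cmod (M (- j))"
      using assms(6) by (simp add: norm_mult norm_chi)
    moreover have "real CARD('a) * cmod (M (- j)) \<le> CARD('a) * K"
    proof -
      have "of_nat CARD('a) * M (- j) = Z 0 (- j)"
        using M_eq[of "- j"] j cardI by simp
      then have "real CARD('a) * cmod (M (- j)) = cmod (Z 0 (- j))"
        by (metis norm_mult norm_of_nat)
      also have "\<dots> \<le> K * sqrt CARD('a)"
        by (rule Z_le)
      also have "\<dots> \<le> CARD('a) * K"
        using q1(2) K0 by (simp add: mult.commute mult_left_mono)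
      finally show ?thesis .
    qed
    ultimately show ?thesis
      by simp
  next
    case False
    define r where "r = j * int k"
    have G: "cmod (gauss (- r)) = sqrt CARD('a)"
      using False by (intro norm_gauss) (simp add: r_def)
    \<comment> \<open>This also holds at \<open>s = 0\<close>, where both sides vanish because
      \<open>chi (- r)\<close> is nontrivial. The modulus \<surd>q of \<open>gauss (- r)\<close>
      later cancels the extra \<surd>q in \<open>Z_le\<close>.\<close>
    have chi_r: "gauss (- r) * chi r s = (\<Sum>t\<in>UNIV. chi (- r) t * psi (t * s))" for s
    proof (cases "s = 0")
      case True
      then show ?thesis
        using False by (simp add: sum_chi r_def)
    next
      case s: False
      then show ?thesis
        using sum_chi_psi[OF s, of "- r"] by (simp add: mult.commute)
    qed
    have "gauss (- r) * E j = (\<Sum>x\<in>P. chi (- j) b * chi (- j) (Q x) * (gauss (- r) * chi r (S x)))"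
      unfolding E_def chi_power_right[OF assms(4)] r_def
      by (simp add: chi_mult sum_distrib_left mult_ac)
    also have "\<dots> = chi (- j) b * Z (- r) (- j)"
      unfolding chi_r Z_def sum_distrib_left by (subst sum.swap) (simp add: mult_ac)
    finally have "cmod (gauss (- r) * E j) = cmod (Z (- r) (- j))"
      using assms(6) by (simp add: norm_mult norm_chi)
    then have "cmod (E j) * sqrt CARD('a) \<le> K * sqrt CARD('a)"
      using Z_le[of "- r" "- j"] by (simp add: norm_mult G mult.commute)
    then show ?thesis
      using q1(1) by (subst (asm) mult_le_cancel_right) simp
  qed

  \<comment> \<open>Characters vanish at 0 and miss the solutions with \<open>Q x = 0\<close>, which
    are exactly the points with \<open>S x = Q x = 0\<close>; the bracket is their
    indicator.\<close>
  have count: "of_nat ordg * of_bool (S x ^ k = b * Q x)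
      = of_nat ordg * (of_bool (S x = 0) - chi 0 (Q x) * of_bool (S x = 0))
        + (\<Sum>j<ordg. chi (int j) (S x ^ k) * chi (- int j) (b * Q x))" for x
  proof (cases "Q x = 0")
    case True
    then show ?thesis
      using assms(4) by (simp add: chi_0_left)
  next
    case False
    have "(\<Sum>j<ordg. chi (int j) (S x ^ k) * chi (- int j) (b * Q x))
        = (\<Sum>j<ordg. chi (int j) (S x ^ k * inverse (b * Q x)))"
      by (simp only: chi_mult[of _ "S x ^ k"] chi_inverse)
    also have "\<dots> = of_nat ordg * of_bool (S x ^ k = b * Q x)"
      unfolding sum_chi_index using False assms(6) by (auto simp: field_simps)
    finally show ?thesis
      using False by (simp add: chi_0_left)
  qed
  have "of_nat ordg * complex_of_nat N = (\<Sum>x\<in>P. of_nat ordg * of_bool (S x ^ k = b * Q x))"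
    unfolding N_def using fin by (simp add: sum_distrib_left[symmetric] sum.If_cases of_bool_def Int_def)
  also have "\<dots> = of_nat ordg * (A - M 0) + (\<Sum>j<ordg. E (int j))"
    unfolding count sum.distrib E_def
    by (subst sum.swap) (simp add: A_def M_def sum_subtractf flip: sum_distrib_left)
  also have "(\<Sum>j<ordg. E (int j)) = E 0 + (\<Sum>j\<in>{..<ordg} - {0}. E (int j))"
    by (subst sum.remove[of _ 0]) auto
  \<comment> \<open>The terms in \<open>M 0\<close> add up to -q \<open>M 0\<close>, whose main part
    cancels \<open>ordg ^ card I\<close> and leaves \<open>- Z 0 0\<close>.\<close>
  also have "of_nat ordg * (A - M 0) + (E 0 + (\<Sum>j\<in>{..<ordg} - {0}. E (int j)))
      = of_nat ordg * A + of_nat ordg ^ card I - of_nat CARD('a) * M 0 + (\<Sum>j\<in>{..<ordg} - {0}. E (int j))"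
    unfolding E_0 q1(3) by (simp add: algebra_simps)
  also have "\<dots> = of_nat ordg * A - Z 0 0 + (\<Sum>j\<in>{..<ordg} - {0}. E (int j))"
    unfolding M_eq by simp
  finally have N_eq: "of_nat ordg * complex_of_nat N
      = of_nat ordg * A - Z 0 0 + (\<Sum>j\<in>{..<ordg} - {0}. E (int j))" .

  have A_le: "cmod (A - of_nat CARD('a) ^ (card I - 1)) \<le> K"
  proof -
    have "of_nat CARD('a) * (A - of_nat CARD('a) ^ (card I - 1)) = z"
      using A_eq cardI by (cases "card I") (auto simp: algebra_simps)
    then have "real CARD('a) * cmod (A - of_nat CARD('a) ^ (card I - 1)) = cmod z"
      by (metis norm_mult norm_of_nat)
    also have "\<dots> \<le> K * sqrt CARD('a)"
      by (rule z_le)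
    also have "\<dots> \<le> CARD('a) * K"
      using q1(2) K0 by (simp add: mult.commute mult_left_mono)
    finally show ?thesis
      by simp
  qed
  have sum_E_le: "cmod (\<Sum>j\<in>{..<ordg} - {0}. E (int j)) \<le> ordg * K"
  proof -
    have "cmod (\<Sum>j\<in>{..<ordg} - {0}. E (int j)) \<le> card ({..<ordg} - {0}) * K"
    proof (rule sum_norm_bound)
      fix j assume "j \<in> {..<ordg} - {0}"
      then have "\<not> int ordg dvd int j"
        by (auto dest: nat_dvd_not_less)
      then show "cmod (E (int j)) \<le> K"
        by (rule E_le)
    qed
    also have "\<dots> \<le> ordg * K"
      using K0 by (intro mult_right_mono) auto
    finally show ?thesis .
  qed
  have "of_nat ordg * (complex_of_nat N - of_nat CARD('a) ^ (card I - 1))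
      = of_nat ordg * (A - of_nat CARD('a) ^ (card I - 1)) - Z 0 0
        + (\<Sum>j\<in>{..<ordg} - {0}. E (int j))"
    using N_eq by (simp add: algebra_simps)
  then have "real ordg * cmod (complex_of_nat N - of_nat CARD('a) ^ (card I - 1))
      = cmod (of_nat ordg * (A - of_nat CARD('a) ^ (card I - 1)) - Z 0 0
        + (\<Sum>j\<in>{..<ordg} - {0}. E (int j)))"
    by (metis norm_mult norm_of_nat)
  also have "\<dots> \<le> cmod (of_nat ordg * (A - of_nat CARD('a) ^ (card I - 1))) + cmod (Z 0 0)
      + cmod (\<Sum>j\<in>{..<ordg} - {0}. E (int j))"
    by (intro order_trans[OF norm_triangle_ineq] add_right_mono norm_triangle_ineq4)
  also have "\<dots> \<le> ordg * K + 2 * ordg * K + ordg * K"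
  proof (intro add_mono sum_E_le)
    show "cmod (of_nat ordg * (A - of_nat CARD('a) ^ (card I - 1))) \<le> ordg * K"
      using A_le by (simp add: norm_mult mult_left_mono)
    \<comment> \<open>Since \<surd>q \<le> q = \<open>ordg + 1\<close>, this absorbs the single sum
      \<open>Z 0 0\<close> when dividing by \<open>ordg\<close>.\<close>
    have "sqrt CARD('a) \<le> 2 * ordg"
      using q1(2) q1(3) ordg_pos(1) by linarith
    then have "K * sqrt CARD('a) \<le> 2 * ordg * K"
      using K0 by (simp add: mult.commute mult_left_mono)
    then show "cmod (Z 0 0) \<le> 2 * ordg * K"
      using Z_le[of 0 0] by linarith
  qed
  also have "\<dots> = real ordg * (4 * K)"
    by simp
  finally have "cmod (complex_of_nat N - of_nat CARD('a) ^ (card I - 1)) \<le> 4 * K"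
    by (subst (asm) mult_le_cancel_left_pos) auto
  also have "complex_of_nat N - of_nat CARD('a) ^ (card I - 1)
      = complex_of_real (real N - real CARD('a) ^ (card I - 1))"
    by simp
  finally show ?thesis
    unfolding norm_of_real N_def K_def P_def S_def Q_def .
qed

end

section \<open>Comparison with the required exponents\<close>

theorem theorem4p1:
  fixes k m n :: nat
    and a b :: "'a::finite_field"
    and c :: "nat \<Rightarrow> 'a"
  assumes "k \<ge> 2" and "m \<ge> 2" and "n \<ge> 3"
    and "\<not> CHAR('a) dvd m * k"
    and "n < m * k"
    and "a \<noteq> 0" and "b \<noteq> 0" and "\<And>i. i \<in> {1..n} \<Longrightarrow> c i \<noteq> 0"
  shows "\<bar>real (card {x \<in> {1..n} \<rightarrow>\<^sub>E (UNIV :: 'a set).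
              ((\<Sum>i=1..n. c i * x i ^ m) + a) ^ k = b * (\<Prod>i=1..n. x i)})
            - real CARD('a) ^ (n - 1)\<bar>
         \<le> 9 * real (m * k) ^ max (n - 1) 4 * real CARD('a) powr (real n - 3 / 2)"
proof -
  define N where "N = card {x \<in> {1..n} \<rightarrow>\<^sub>E (UNIV :: 'a set).
    ((\<Sum>i=1..n. c i * x i ^ m) + a) ^ k = b * (\<Prod>i=1..n. x i)}"
  define q where "q = real CARD('a)"
  define D where "D = max (n - 1) 4"
  have "CARD('a) > 0"
    by simp
  then have q: "q \<ge> 1"
    unfolding q_def by linarith
  have m: "real m \<ge> 1"
    using assms(2) by simp
  have mk: "real m \<le> real (m * k)"
    using assms(1) by (simp flip: of_nat_mult)
  have nD: "9 * real m ^ D * q powr (real n - 3 / 2) \<le> 9 * real (m * k) ^ D * q powr (real n - 3 / 2)"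
    by (intro mult_right_mono mult_left_mono power_mono mk) auto
  show ?thesis
  \<comment> \<open>For n \<ge> 5 the target has only \<open>m ^ (n - 1)\<close>, one factor
    \<open>m\<close> short of 4 (m \<surd>q)^n. If m \<le> q that factor is traded for
    \<open>q\<close>; if m > q, the trivial bound q^n suffices, as q^(3/2) \<le> q^D \<le>
    m^D.\<close>
  proof (cases "n \<ge> 5 \<and> real m > q")
    case True
    have "N \<le> card ({1..n} \<rightarrow>\<^sub>E (UNIV :: 'a set))"
      unfolding N_def by (intro card_mono finite_PiE) auto
    then have "real N \<le> real (CARD('a) ^ n)"
      by (simp add: card_PiE)
    then have "real N \<le> q ^ n"
      by (simp add: q_def)
    moreover have "q ^ (n - 1) \<le> q ^ n"
      using q by (intro power_increasing) auto
    moreover have "q ^ (n - 1) \<ge> 0"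
      using q by simp
    ultimately have "\<bar>real N - q ^ (n - 1)\<bar> \<le> q ^ n"
      by linarith
    also have "q ^ n = q powr (3 / 2) * q powr (real n - 3 / 2)"
      using q by (simp add: powr_realpow flip: powr_add)
    also have "q powr (3 / 2) \<le> q powr D"
      using q by (intro powr_mono) (auto simp: D_def)
    also have "q powr D = q ^ D"
      using q by (simp add: powr_realpow)
    also have "q ^ D \<le> real m ^ D"
      using q True by (intro power_mono) auto
    also have "\<dots> \<le> 9 * real m ^ D"
      by simp
    finally have "\<bar>real N - q ^ (n - 1)\<bar> \<le> 9 * real m ^ D * q powr (real n - 3 / 2)"
      by (simp add: mult_right_mono)
    from this nD show ?thesis
      unfolding N_def q_def D_def by (rule order_trans)
  next
    case False
    obtain g :: 'a where g: "g \<noteq> 0" "\<And>x. x \<noteq> 0 \<Longrightarrow> \<exists>i::nat. x = g ^ i"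
      by (rule finite_field_generator) blast
    obtain psi :: "'a \<Rightarrow> complex" where psi: "\<And>x y. psi (x + y) = psi x * psi y"
      "\<And>x. cmod (psi x) = 1" "psi 1 \<noteq> 1"
      by (rule exists_additive_character) blast
    interpret finite_field_characters g psi
      by unfold_locales (use g psi in auto)
    have "\<bar>real N - q ^ (n - 1)\<bar> \<le> 4 * (m * sqrt q) ^ n"
      using card_solutions_le[of "{1..n}" m k a b c] assms by (simp add: N_def q_def)
    also have "\<dots> = 4 * (real m ^ n * q powr (n / 2))"
    proof -
      have "sqrt q ^ n = q powr (n / 2)"
        using q by (simp add: powr_half_sqrt[symmetric] powr_power)
      then show ?thesis
        by (simp add: power_mult_distrib)
    qed
    also have "real m ^ n * q powr (n / 2) \<le> real m ^ D * q powr (real n - 3 / 2)"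
    proof (cases "n \<ge> 5")
      case True
      then have "real m ^ n * q powr (n / 2) = real m ^ (n - 1) * (real m * q powr (n / 2))"
        by (simp add: power_eq_if)
      also have "\<dots> \<le> real m ^ (n - 1) * (q powr 1 * q powr (n / 2))"
        using False True q by (intro mult_left_mono mult_right_mono) auto
      \<comment> \<open>The inequality 1 + n/2 \<le> n - 3/2 is exactly n \<ge> 5.\<close>
      also have "q powr 1 * q powr (n / 2) \<le> q powr (real n - 3 / 2)"
        unfolding powr_add[symmetric] using True q by (intro powr_mono) auto
      finally show ?thesis
        using True by (simp add: D_def mult_left_mono)
    next
      case False
      \<comment> \<open>Now \<open>n\<close> is 3 or 4, so n \<le> D = 4, and n/2 \<le> n - 3/2
        holds because n \<ge> 3.\<close>
      then show ?thesis
        using assms(3) m q by (intro mult_mono power_increasing powr_mono) (auto simp: D_def)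
    qed
    finally have "\<bar>real N - q ^ (n - 1)\<bar> \<le> 4 * (real m ^ D * q powr (real n - 3 / 2))"
      by simp
    also have "\<dots> \<le> 9 * real m ^ D * q powr (real n - 3 / 2)"
      by simp
    finally show ?thesis
      using nD unfolding N_def q_def D_def by (rule order_trans)
  qed
qed

end
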